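(* Let $n\in\mathbb{N}$, let $f_1,\ldots,f_n\colon\Omega\to\mathbb{R}$ be local functions, let $\Psi\colon\mathbb{R}^n\to\mathbb{R}$ be $C^\infty$ with uniformly bounded derivatives of all orders, and let $$F(\mu)=\Psi\big(\langle f_1,\mu\rangle,\ldots,\langle f_n,\mu\rangle\big).$$ Let $\mu$ be a probability measure on $\Omega$ and let $(\sigma^{(N)})_{N\in\mathbb{N}}$ be a sequence of configurations with $\sigma^{(N)}\in\Omega_N$ such that $\mathcal{L}_N(\sigma^{(N)})\to\mu$ weakly as $N\to\infty$. Then the limit $(HF)(\mu)=\lim_{N\to\infty}(H_NF)(\mathcal{L}_N(\sigma^{(N)}))$ exists and $$(HF)(\mu)=\left\langle c\left(\exp\left[\sum_{i=1}^n\frac{\partial\Psi}{\partial x_i}\big(\langle f_1,\mu\rangle,\ldots,\langle f_n,\mu\rangle\big)\,\mathcal{D}f_i\right]-1\right),\mu\right\rangle.$$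
   Context: Let $d\ge 1$. For $N\in\mathbb{N}$ let $\mathbb{T}_N^d=(\mathbb{Z}/(2N+1)\mathbb{Z})^d$ be the $d$-dimensional torus, identified with $\Lambda_N^d=([-N,N]\cap\mathbb{Z})^d$, and let $|\mathbb{T}_N^d|=(2N+1)^d$ be its cardinality. Let $\Omega_N=\{-1,1\}^{\mathbb{T}_N^d}$ and $\Omega=\{-1,1\}^{\mathbb{Z}^d}$. A function $f\colon\Omega\to\mathbb{R}$ is local if it depends on only finitely many coordinates $\sigma_j$, $j\in\mathbb{Z}^d$; when $\Lambda_N^d$ contains the dependence set of $f$ (which holds for $N$ large enough), $f$ is also viewed as a function on $\Omega_N$ via the identification of $\mathbb{T}_N^d$ with $\Lambda_N^d$. For $\sigma\in\Omega_N$ and $i\in\mathbb{T}_N^d$, the shift is $(\tau_i\sigma)_j=\sigma_{i+j}$ (addition modulo $2N+1$), and $\sigma^i$ is the configuration obtained from $\sigma$ by flipping the spin at site $i$. The spin-flip rates are given by a strictly positive local function $c\colon\Omega\to(0,\infty)$ (viewed as a function on $\Omega_N$ for $N$ large), with translation-invariant rates $c_i(\sigma)=c(\tau_i\sigma)$. The generator $L_N$ acts on functions $g\colon\Omega_N\to\mathbb{R}$ by $$(L_N g)(\sigma)=\sum_{i\in\mathbb{T}_N^d}c_i(\sigma)\,[g(\sigma^i)-g(\sigma)].$$ The empirical measure of $\sigma\in\Omega_N$ is $\mathcal{L}_N(\sigma)=\frac{1}{|\mathbb{T}_N^d|}\sum_{i\in\mathbb{T}_N^d}\delta_{\tau_i\sigma}$,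 a probability measure on $\Omega_N$. For a measure $\mu$ and a function $f$ write $\langle f,\mu\rangle=\int f\,d\mu$. A sequence of probability measures $\mu_N$ on $\Omega_N$ converges weakly to a probability measure $\mu$ on $\Omega$ if $\lim_{N\to\infty}\int_{\Omega_N}f\,d\mu_N=\int_\Omega f\,d\mu$ for every local $f$. A functional $F$ of the form $F(\mu)=\Psi(\langle f_1,\mu\rangle,\ldots,\langle f_n,\mu\rangle)$ with local $f_i$ is defined for probability measures on $\Omega$ and, for $N$ large enough, for probability measures on $\Omega_N$. The non-linear generator $H_N$ is defined by $$(H_NF)(\mathcal{L}_N(\sigma))=\frac{1}{|\mathbb{T}_N^d|}\,e^{-|\mathbb{T}_N^d|F(\mathcal{L}_N(\sigma))}\,L_N\!\left(e^{|\mathbb{T}_N^d|(F\circ\mathcal{L}_N)}\right)(\sigma),\qquad \sigma\in\Omega_N .$$ For finite $A\subset\mathbb{Z}^d$ let $H_A(\sigma)=\prod_{i\in A}\sigma_i$ ($H_\emptyset=1$); every local function is a finite linear combination of such functions. $\mathcal{D}$ is the linear operator on local functions $f\colon\Omega\to\mathbb{R}$ determined by $$\mathcal{D}1=0,\qquad \mathcal{D}H_A=\sum_{r\in -A}(-2)\,H_{A+r},$$ where $-A=\{-a:a\in A\}$ and $A+r=\{a+r:a\in A\}$, with addition in $\mathbb{Z}^d$. *)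

theory Defs
  imports "HOL-Probability.Probability"
begin

section \<open>Configurations and local functions\<close>

text \<open>
  A configuration assigns a real number to every site of \<open>\<int>\<^sup>d\<close>, \<open>d = CARD('d)\<close>. The spin values are
  the reals \<open>-1\<close> and \<open>1\<close>; this is enforced by the carrier \<open>Omega\<close>, so every property of a function
  on configurations below is relativised to \<open>Omega\<close>.
\<close>

type_synonym 'd config = "(int, 'd) vec \<Rightarrow> real"

definition Omega :: "'d::finite config set" where
  "Omega = {\<sigma>. \<forall>j. \<sigma> j \<in> {-1, 1}}"

text \<open>Since \<open>\<int>\<^sup>d\<close> is countable, this product \<open>\<sigma>\<close>-algebra is the Borel \<open>\<sigma>\<close>-algebra of \<open>Omega\<close>.\<close>

definition spin_space :: "'d::finite config measure" where
  "spin_space = (\<Pi>\<^sub>M j\<in>UNIV. count_space {-1, 1})"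

definition local_fun :: "('d::finite config \<Rightarrow> real) \<Rightarrow> bool" where
  "local_fun f \<longleftrightarrow>
     (\<exists>S. finite S \<and> (\<forall>\<sigma>\<in>Omega. \<forall>\<eta>\<in>Omega. (\<forall>j\<in>S. \<sigma> j = \<eta> j) \<longrightarrow> f \<sigma> = f \<eta>))"


section \<open>The torus\<close>

text \<open>The torus is represented by the box \<open>[-N, N]\<^sup>d\<close>; \<open>wrap N\<close> reduces a site modulo \<open>2 N + 1\<close>.\<close>

definition torus :: "nat \<Rightarrow> (int, 'd::finite) vec set" where
  "torus N = {j. \<forall>k. - int N \<le> j $ k \<and> j $ k \<le> int N}"

definition wrap :: "nat \<Rightarrow> (int, 'd::finite) vec \<Rightarrow> (int, 'd) vec" where
  "wrap N j = (\<chi> k. (j $ k + int N) mod (2 * int N + 1) - int N)"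

definition Omega_N :: "nat \<Rightarrow> 'd::finite config set" where
  "Omega_N N = torus N \<rightarrow>\<^sub>E {-1, 1}"

definition torus_shift :: "nat \<Rightarrow> (int, 'd::finite) vec \<Rightarrow> 'd config \<Rightarrow> 'd config" where
  "torus_shift N i \<sigma> = (\<lambda>j\<in>torus N. \<sigma> (wrap N (i + j)))"

definition flip_at :: "(int, 'd::finite) vec \<Rightarrow> 'd config \<Rightarrow> 'd config" where
  "flip_at i \<sigma> = \<sigma>(i := - \<sigma> i)"

text \<open>
  A local function, viewed as a function on \<open>Omega_N N\<close>: evaluate it at some configuration on \<open>\<int>\<^sup>d\<close>
  that agrees with \<open>\<sigma>\<close> on the box. The periodic one is used; once the box contains the dependence
  set of \<open>f\<close> the choice is irrelevant, and smaller \<open>N\<close> play no role in limits.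
\<close>

definition on_torus :: "nat \<Rightarrow> ('d::finite config \<Rightarrow> real) \<Rightarrow> 'd config \<Rightarrow> real" where
  "on_torus N f \<sigma> = f (\<lambda>j. \<sigma> (wrap N j))"

lemma wrap_in_torus: "wrap N j \<in> torus N"
proof -
  have "0 \<le> (j $ k + int N) mod (2 * int N + 1)"
    "(j $ k + int N) mod (2 * int N + 1) < 2 * int N + 1" for k
    by (simp, rule pos_mod_bound, simp)
  then show ?thesis
    by (simp add: wrap_def torus_def)
qed

lemma wrap_torus: "j \<in> torus N \<Longrightarrow> wrap N j = j"
proof -
  assume j: "j \<in> torus N"
  have "(j $ k + int N) mod (2 * int N + 1) = j $ k + int N" for k
    using j[unfolded torus_def] by (intro mod_pos_pos_trivial) (auto simp: algebra_simps dest: spec[of _ k])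
  then show ?thesis by (simp add: wrap_def vec_eq_iff)
qed

lemma torus_eq_image:
  "(torus N :: (int, 'd::finite) vec set) = (\<lambda>g. \<chi> k. g k) ` (UNIV \<rightarrow>\<^sub>E {- int N..int N})"
proof (intro set_eqI iffI)
  fix j :: "(int, 'd) vec" assume "j \<in> torus N"
  then show "j \<in> (\<lambda>g. \<chi> k. g k) ` (UNIV \<rightarrow>\<^sub>E {- int N..int N})"
    by (intro image_eqI[of _ _ "\<lambda>k. j $ k"]) (auto simp: torus_def)
qed (auto simp: torus_def)

lemma finite_torus: "finite (torus N)"
  unfolding torus_eq_image by (intro finite_imageI finite_PiE) auto

lemma torus_nonempty: "torus N \<noteq> {}"
  using wrap_in_torus by blast

lemma card_torus: "card (torus N :: (int, 'd::finite) vec set) = (2 * N + 1) ^ CARD('d)"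
proof -
  have "inj_on (\<lambda>g. (\<chi> k. g k) :: (int, 'd) vec) (UNIV \<rightarrow>\<^sub>E {- int N..int N} :: ('d \<Rightarrow> int) set)"
    by (auto simp: inj_on_def vec_eq_iff)
  moreover have "nat (2 * int N + 1) = 2 * N + 1" by simp
  ultimately show ?thesis
    unfolding torus_eq_image by (simp add: card_image card_PiE)
qed

lemma torus_shift_in_Omega_N: "\<sigma> \<in> Omega_N N \<Longrightarrow> torus_shift N i \<sigma> \<in> Omega_N N"
  using wrap_in_torus by (auto simp: torus_shift_def Omega_N_def PiE_def Pi_def)

lemma flip_at_in_Omega_N: "\<sigma> \<in> Omega_N N \<Longrightarrow> i \<in> torus N \<Longrightarrow> flip_at i \<sigma> \<in> Omega_N N"
  by (auto simp: flip_at_def Omega_N_def PiE_def Pi_def extensional_def)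

lemma on_torus_eq:
  assumes "\<And>\<sigma> \<eta>. \<sigma> \<in> Omega \<Longrightarrow> \<eta> \<in> Omega \<Longrightarrow> (\<And>j. j \<in> S \<Longrightarrow> \<sigma> j = \<eta> j) \<Longrightarrow> f \<sigma> = f \<eta>"
    and "S \<subseteq> torus N" "\<sigma> \<in> Omega_N N" "\<eta> \<in> Omega" "\<And>j. j \<in> torus N \<Longrightarrow> \<eta> j = \<sigma> j"
  shows "on_torus N f \<sigma> = f \<eta>"
  unfolding on_torus_def
proof (rule assms(1))
  show "(\<lambda>j. \<sigma> (wrap N j)) \<in> Omega"
    using assms(3) wrap_in_torus by (auto simp: Omega_def Omega_N_def PiE_def Pi_def)
  show "\<sigma> (wrap N j) = \<eta> j" if "j \<in> S" for j
    using that assms(2,5) by (auto simp: wrap_torus)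
qed (rule assms(4))


section \<open>The spin-flip_at dynamics, empirical measures and the non-linear generator\<close>

definition gen :: "nat \<Rightarrow> ('d::finite config \<Rightarrow> real) \<Rightarrow> ('d config \<Rightarrow> real) \<Rightarrow> 'd config \<Rightarrow> real" where
  "gen N c g \<sigma> = (\<Sum>i\<in>torus N. on_torus N c (torus_shift N i \<sigma>) * (g (flip_at i \<sigma>) - g \<sigma>))"

text \<open>The average of the Dirac measures at \<open>torus_shift N i \<sigma>\<close> is the law of \<open>torus_shift N i \<sigma>\<close> for uniform \<open>i\<close>.\<close>

definition empirical :: "nat \<Rightarrow> 'd::finite config \<Rightarrow> 'd config measure" where
  "empirical N \<sigma> =
     distr (uniform_count_measure (torus N)) (count_space (Omega_N N)) (\<lambda>i. torus_shift N i \<sigma>)"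

definition weakly_converges :: "(nat \<Rightarrow> 'd::finite config measure) \<Rightarrow> 'd config measure \<Rightarrow> bool" where
  "weakly_converges \<mu>s \<mu> \<longleftrightarrow>
     (\<forall>f. local_fun f \<longrightarrow> (\<lambda>N. \<integral>\<sigma>. on_torus N f \<sigma> \<partial>\<mu>s N) \<longlonglongrightarrow> (\<integral>\<sigma>. f \<sigma> \<partial>\<mu>))"

definition cylinder ::
    "((real, 'n::finite) vec \<Rightarrow> real) \<Rightarrow> ('n \<Rightarrow> 'd::finite config \<Rightarrow> real) \<Rightarrow> 'd config measure \<Rightarrow> real" where
  "cylinder \<Psi> f \<mu> = \<Psi> (\<chi> i. \<integral>\<sigma>. f i \<sigma> \<partial>\<mu>)"

text \<open>
  \<open>nonlin_gen N c F \<sigma>\<close> is \<open>(H\<^sub>N F)(\<L>\<^sub>N(\<sigma>))\<close>, for a functional \<open>F\<close> of the probability measures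
  on \<open>Omega_N N\<close>.
\<close>

definition nonlin_gen ::
    "nat \<Rightarrow> ('d::finite config \<Rightarrow> real) \<Rightarrow> ('d config measure \<Rightarrow> real) \<Rightarrow> 'd config \<Rightarrow> real" where
  "nonlin_gen N c F \<sigma> =
     (let T = real (card (torus N :: (int, 'd) vec set))
      in 1 / T * exp (- T * F (empirical N \<sigma>)) * gen N c (\<lambda>\<eta>. exp (T * F (empirical N \<eta>))) \<sigma>)"

lemma empirical_eq_average:
  fixes \<sigma> :: "'d::finite config"
  assumes "\<sigma> \<in> Omega_N N" "B \<subseteq> Omega_N N"
  shows "measure (empirical N \<sigma>) B =
    (\<Sum>i\<in>torus N. measure (return (count_space (Omega_N N)) (torus_shift N i \<sigma>)) B)
      / real (card (torus N :: (int, 'd) vec set))"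
proof -
  let ?U = "uniform_count_measure (torus N :: (int, 'd) vec set)"
  have "measure (empirical N \<sigma>) B = measure ?U ((\<lambda>i. torus_shift N i \<sigma>) -` B \<inter> torus N)"
    unfolding empirical_def using assms
    by (subst measure_distr)
       (auto simp: measurable_def space_uniform_count_measure sets_uniform_count_measure torus_shift_in_Omega_N)
  also have "\<dots> = real (card ((\<lambda>i. torus_shift N i \<sigma>) -` B \<inter> torus N))
      / real (card (torus N :: (int, 'd) vec set))"
    using finite_torus[of N] by (subst measure_uniform_count_measure) auto
  also have "real (card ((\<lambda>i. torus_shift N i \<sigma>) -` B \<inter> torus N)) =
      (\<Sum>i\<in>torus N. indicator B (torus_shift N i \<sigma>))"
    using sum.inter_filter[OF finite_torus, of "\<lambda>_. 1 :: real" N "\<lambda>i. torus_shift N i \<sigma> \<in> B"]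
    by (simp add: indicator_def of_bool_def Int_def vimage_def conj_commute)
  also have "\<dots> = (\<Sum>i\<in>torus N. measure (return (count_space (Omega_N N)) (torus_shift N i \<sigma>)) B)"
    using assms by (intro sum.cong) (auto simp: measure_return)
  finally show ?thesis .
qed

lemma prob_space_empirical:
  assumes "\<sigma> \<in> Omega_N N"
  shows "prob_space (empirical N \<sigma>)"
  unfolding empirical_def using assms
  by (intro prob_space.prob_space_distr prob_space_uniform_count_measure finite_torus torus_nonempty)
     (auto simp: measurable_def space_uniform_count_measure sets_uniform_count_measure torus_shift_in_Omega_N)


section \<open>Partial derivatives and smoothness\<close>

definition partial :: "'n::finite \<Rightarrow> ((real, 'n) vec \<Rightarrow> real) \<Rightarrow> (real, 'n) vec \<Rightarrow> real" where
  "partial i g x = frechet_derivative g (at x) (axis i 1)"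

primrec iter_partial :: "'n::finite list \<Rightarrow> ((real, 'n) vec \<Rightarrow> real) \<Rightarrow> (real, 'n) vec \<Rightarrow> real" where
  "iter_partial [] g = g"
| "iter_partial (i # is) g = partial i (iter_partial is g)"

text \<open>
  Total differentiability of all iterated partial derivatives makes them continuous, so this is
  \<open>C\<^sup>\<infinity>\<close>. The bounds concern the derivatives of order at least one; \<open>g\<close> itself may be unbounded.
\<close>

definition smooth :: "((real, 'n::finite) vec \<Rightarrow> real) \<Rightarrow> bool" where
  "smooth g \<longleftrightarrow> (\<forall>is x. iter_partial is g differentiable (at x))"

definition bounded_derivs :: "((real, 'n::finite) vec \<Rightarrow> real) \<Rightarrow> bool" where
  "bounded_derivs g \<longleftrightarrow> (\<forall>is. is \<noteq> [] \<longrightarrow> (\<exists>C. \<forall>x. \<bar>iter_partial is g x\<bar> \<le> C))"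


section \<open>The operator \<open>\<D>\<close>\<close>

definition walsh :: "(int, 'd::finite) vec set \<Rightarrow> 'd config \<Rightarrow> real" where
  "walsh A \<sigma> = (\<Prod>i\<in>A. \<sigma> i)"

definition walsh_expansion ::
    "('d::finite config \<Rightarrow> real) \<Rightarrow> ((int, 'd) vec set \<Rightarrow> real) \<Rightarrow> bool" where
  "walsh_expansion f a \<longleftrightarrow>
     finite {A. a A \<noteq> 0} \<and> (\<forall>A. a A \<noteq> 0 \<longrightarrow> finite A) \<and>
     (\<forall>\<sigma>\<in>Omega. f \<sigma> = (\<Sum>A | a A \<noteq> 0. a A * walsh A \<sigma>))"

text \<open>
  Local functions have exactly one such expansion (\<open>walsh_expansion_ex1\<close> below), so the operator is
  the linear extension of its values on the \<open>walsh A\<close>.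
\<close>

definition D_op :: "('d::finite config \<Rightarrow> real) \<Rightarrow> 'd config \<Rightarrow> real" where
  "D_op f \<sigma> = (let a = (THE a. walsh_expansion f a) in
     \<Sum>A | a A \<noteq> 0. a A * (\<Sum>r\<in>uminus ` A. (-2) * walsh ((\<lambda>j. j + r) ` A) \<sigma>))"

lemma walsh_coeffs_exist_aux:
  fixes f :: "'d::finite config \<Rightarrow> real"
  assumes "finite S"
    and "\<forall>\<sigma>\<in>Omega. \<forall>\<eta>\<in>Omega. (\<forall>j\<in>S. \<sigma> j = \<eta> j) \<longrightarrow> f \<sigma> = f \<eta>"
  shows "\<exists>a. \<forall>\<sigma>\<in>Omega. f \<sigma> = (\<Sum>A\<in>Pow S. a A * walsh A \<sigma>)"
  using assms
proof (induction S arbitrary: f rule: finite_induct)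
  case empty
  have one: "(\<lambda>_. 1) \<in> Omega" by (simp add: Omega_def)
  have "f \<sigma> = f (\<lambda>_. 1)" if "\<sigma> \<in> Omega" for \<sigma>
    using empty that one by blast
  then show ?case
    by (intro exI[of _ "\<lambda>_. f (\<lambda>_. 1)"]) (simp add: walsh_def)
next
  case (insert s S)
  define g where "g \<sigma> = (f (\<sigma>(s := 1)) + f (\<sigma>(s := -1))) / 2" for \<sigma>
  define h where "h \<sigma> = (f (\<sigma>(s := 1)) - f (\<sigma>(s := -1))) / 2" for \<sigma>
  have upd: "\<sigma>(s := x) \<in> Omega" if "\<sigma> \<in> Omega" "x \<in> {-1, 1}" for \<sigma> x
    using that by (auto simp: Omega_def)
  have f_upd: "f (\<sigma>(s := x)) = f (\<eta>(s := x))"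
    if "\<sigma> \<in> Omega" "\<eta> \<in> Omega" "\<forall>j\<in>S. \<sigma> j = \<eta> j" "x \<in> {-1, 1}" for \<sigma> \<eta> x
    by (rule insert.prems[rule_format]) (use that in \<open>auto intro!: upd\<close>)
  have "\<exists>a. \<forall>\<sigma>\<in>Omega. g \<sigma> = (\<Sum>A\<in>Pow S. a A * walsh A \<sigma>)"
  proof (intro insert.IH ballI impI)
    fix \<sigma> \<eta> assume "\<sigma> \<in> Omega" "\<eta> \<in> Omega" "\<forall>j\<in>S. \<sigma> j = \<eta> j"
    then show "g \<sigma> = g \<eta>"
      using f_upd[of \<sigma> \<eta> 1] f_upd[of \<sigma> \<eta> "-1"] by (simp add: g_def)
  qed
  then obtain a where a: "\<And>\<sigma>. \<sigma> \<in> Omega \<Longrightarrow> g \<sigma> = (\<Sum>A\<in>Pow S. a A * walsh A \<sigma>)" by blast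
  have "\<exists>b. \<forall>\<sigma>\<in>Omega. h \<sigma> = (\<Sum>A\<in>Pow S. b A * walsh A \<sigma>)"
  proof (intro insert.IH ballI impI)
    fix \<sigma> \<eta> assume "\<sigma> \<in> Omega" "\<eta> \<in> Omega" "\<forall>j\<in>S. \<sigma> j = \<eta> j"
    then show "h \<sigma> = h \<eta>"
      using f_upd[of \<sigma> \<eta> 1] f_upd[of \<sigma> \<eta> "-1"] by (simp add: h_def)
  qed
  then obtain b where b: "\<And>\<sigma>. \<sigma> \<in> Omega \<Longrightarrow> h \<sigma> = (\<Sum>A\<in>Pow S. b A * walsh A \<sigma>)" by blast
  define a' where "a' A = (if s \<in> A then b (A - {s}) else a A)" for A
  have "f \<sigma> = (\<Sum>A\<in>Pow (insert s S). a' A * walsh A \<sigma>)" if \<sigma>: "\<sigma> \<in> Omega" for \<sigma>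
  proof -
    have "\<sigma> s = 1 \<or> \<sigma> s = -1" using \<sigma> by (auto simp: Omega_def)
    then have "f \<sigma> = g \<sigma> + \<sigma> s * h \<sigma>"
    proof
      assume "\<sigma> s = 1"
      then have "\<sigma>(s := 1) = \<sigma>" by auto
      then show ?thesis using \<open>\<sigma> s = 1\<close> by (simp add: g_def h_def field_simps)
    next
      assume "\<sigma> s = -1"
      then have "\<sigma>(s := -1) = \<sigma>" by auto
      then show ?thesis using \<open>\<sigma> s = -1\<close> by (simp add: g_def h_def field_simps)
    qed
    also have "g \<sigma> = (\<Sum>A\<in>Pow S. a' A * walsh A \<sigma>)"
      unfolding a[OF \<sigma>] using insert.hyps by (intro sum.cong) (auto simp: a'_def)
    also have "\<sigma> s * h \<sigma> = (\<Sum>A\<in>Pow S. a' (insert s A) * walsh (insert s A) \<sigma>)"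
      unfolding b[OF \<sigma>] sum_distrib_left
    proof (rule sum.cong)
      fix A assume "A \<in> Pow S"
      then have "finite A" "s \<notin> A" using insert.hyps finite_subset by auto
      then show "\<sigma> s * (b A * walsh A \<sigma>) = a' (insert s A) * walsh (insert s A) \<sigma>"
        by (simp add: a'_def walsh_def)
    qed simp
    also have "\<dots> = (\<Sum>A\<in>insert s ` Pow S. a' A * walsh A \<sigma>)"
      using insert.hyps by (subst sum.reindex) (auto simp: inj_on_def)
    also have "(\<Sum>A\<in>Pow S. a' A * walsh A \<sigma>) + \<dots> = (\<Sum>A\<in>Pow (insert s S). a' A * walsh A \<sigma>)"
      unfolding Pow_insert using insert.hyps by (subst sum.union_disjoint) auto
    finally show ?thesis .
  qed
  then show ?case by blast
qed

lemma walsh_independent_aux: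
  fixes a :: "(int, 'd::finite) vec set \<Rightarrow> real"
  assumes "finite S" "\<forall>\<sigma>\<in>Omega. (\<Sum>A\<in>Pow S. a A * walsh A \<sigma>) = 0" "A \<subseteq> S"
  shows "a A = 0"
  using assms
proof (induction S arbitrary: a A rule: finite_induct)
  case empty
  have one: "(\<lambda>_. 1) \<in> Omega" by (simp add: Omega_def)
  from bspec[OF empty(1) one] empty(2) show ?case by (simp add: walsh_def)
next
  case (insert s S)
  have key: "a B + x * a (insert s B) = 0" if x: "x \<in> {-1, 1}" and B: "B \<subseteq> S" for x B
  proof (rule insert.IH[of "\<lambda>B. a B + x * a (insert s B)" B])
    show "\<forall>\<sigma>\<in>Omega. (\<Sum>B\<in>Pow S. (a B + x * a (insert s B)) * walsh B \<sigma>) = 0"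
    proof
      fix \<sigma> :: "'d config" assume "\<sigma> \<in> Omega"
      then have \<sigma>: "\<sigma>(s := x) \<in> Omega" using x by (auto simp: Omega_def)
      have "(\<Sum>B\<in>Pow S. (a B + x * a (insert s B)) * walsh B \<sigma>) =
          (\<Sum>B\<in>Pow S. a B * walsh B (\<sigma>(s := x))) +
          (\<Sum>B\<in>Pow S. a (insert s B) * walsh (insert s B) (\<sigma>(s := x)))"
        unfolding sum.distrib[symmetric]
      proof (rule sum.cong)
        fix B assume "B \<in> Pow S"
        then have B: "finite B" "s \<notin> B" using insert.hyps finite_subset by auto
        then have "walsh B (\<sigma>(s := x)) = walsh B \<sigma>"
          unfolding walsh_def by (intro prod.cong) auto
        moreover have "walsh (insert s B) (\<sigma>(s := x)) = x * walsh B (\<sigma>(s := x))"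
          using B by (simp add: walsh_def)
        ultimately show "(a B + x * a (insert s B)) * walsh B \<sigma> =
            a B * walsh B (\<sigma>(s := x)) + a (insert s B) * walsh (insert s B) (\<sigma>(s := x))"
          by (simp add: algebra_simps)
      qed simp
      also have "(\<Sum>B\<in>Pow S. a (insert s B) * walsh (insert s B) (\<sigma>(s := x))) =
          (\<Sum>B\<in>insert s ` Pow S. a B * walsh B (\<sigma>(s := x)))"
        using insert.hyps by (subst sum.reindex) (auto simp: inj_on_def)
      also have "(\<Sum>B\<in>Pow S. a B * walsh B (\<sigma>(s := x))) + \<dots> =
          (\<Sum>B\<in>Pow (insert s S). a B * walsh B (\<sigma>(s := x)))"
        unfolding Pow_insert using insert.hyps by (subst sum.union_disjoint) auto
      also have "\<dots> = 0" using insert.prems(1) \<sigma> by blast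
      finally show "(\<Sum>B\<in>Pow S. (a B + x * a (insert s B)) * walsh B \<sigma>) = 0" .
    qed
  qed (rule B)
  have both: "a B = 0 \<and> a (insert s B) = 0" if "B \<subseteq> S" for B
    using key[of 1 B] key[of "-1" B] that by auto
  show ?case
  proof (cases "s \<in> A")
    case True
    then have "insert s (A - {s}) = A" "A - {s} \<subseteq> S" using insert.prems(2) by auto
    then show ?thesis using both[of "A - {s}"] by simp
  next
    case False
    then show ?thesis using both[of A] insert.prems(2) by blast
  qed
qed

lemma sum_support:
  fixes a :: "'a set \<Rightarrow> real"
  assumes "finite S" "{A. a A \<noteq> 0} \<subseteq> Pow S"
  shows "(\<Sum>A | a A \<noteq> 0. a A * h A) = (\<Sum>A\<in>Pow S. a A * h A)"
  using assms by (intro sum.mono_neutral_left) auto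

lemma walsh_expansion_ex1:
  assumes "local_fun f"
  shows "\<exists>!a. walsh_expansion f a"
proof -
  obtain S where S: "finite S"
    "\<forall>\<sigma>\<in>Omega. \<forall>\<eta>\<in>Omega. (\<forall>j\<in>S. \<sigma> j = \<eta> j) \<longrightarrow> f \<sigma> = f \<eta>"
    using assms unfolding local_fun_def by blast
  obtain a where a: "\<And>\<sigma>. \<sigma> \<in> Omega \<Longrightarrow> f \<sigma> = (\<Sum>A\<in>Pow S. a A * walsh A \<sigma>)"
    using walsh_coeffs_exist_aux[OF S] by blast
  define a' where "a' A = (if A \<subseteq> S then a A else 0)" for A
  have supp: "{A. a' A \<noteq> 0} \<subseteq> Pow S" by (auto simp: a'_def)
  have "walsh_expansion f a'"
    unfolding walsh_expansion_def
  proof (intro conjI ballI allI impI)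
    show "finite {A. a' A \<noteq> 0}" using supp S(1) finite_subset by blast
    show "finite A" if "a' A \<noteq> 0" for A using supp S(1) that finite_subset by blast
    show "f \<sigma> = (\<Sum>A | a' A \<noteq> 0. a' A * walsh A \<sigma>)" if "\<sigma> \<in> Omega" for \<sigma>
      unfolding sum_support[OF S(1) supp] a[OF that]
      by (intro sum.cong) (auto simp: a'_def)
  qed
  moreover have "b = b'" if b: "walsh_expansion f b" and b': "walsh_expansion f b'" for b b'
  proof -
    define U where "U = \<Union>({A. b A \<noteq> 0} \<union> {A. b' A \<noteq> 0})"
    have U: "finite U" "{A. b A \<noteq> 0} \<subseteq> Pow U" "{A. b' A \<noteq> 0} \<subseteq> Pow U"
      using b b' by (auto simp: U_def walsh_expansion_def)
    have "(\<Sum>A\<in>Pow U. (b A - b' A) * walsh A \<sigma>) = 0" if "\<sigma> \<in> Omega" for \<sigma>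
      using b b' that
      by (simp add: walsh_expansion_def sum_support[OF U(1,2)] sum_support[OF U(1,3)]
          left_diff_distrib sum_subtractf)
    then have *: "b A - b' A = 0" if "A \<subseteq> U" for A
      using walsh_independent_aux[OF U(1), of "\<lambda>A. b A - b' A"] that by blast
    show "b = b'"
    proof
      fix A show "b A = b' A"
      proof (cases "A \<subseteq> U")
        case True
        then show ?thesis using * by simp
      next
        case False
        then have "b A = 0" "b' A = 0" using U(2,3) by blast+
        then show ?thesis by simp
      qed
    qed
  qed
  ultimately show ?thesis by blast
qed

lemma D_op_eq:
  assumes "local_fun f" "walsh_expansion f a" "finite S" "{A. a A \<noteq> 0} \<subseteq> Pow S"
  shows "D_op f \<sigma> = (\<Sum>A\<in>Pow S. a A * (\<Sum>r\<in>uminus ` A. (-2) * walsh ((\<lambda>j. j + r) ` A) \<sigma>))"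
proof -
  have "(THE a. walsh_expansion f a) = a"
    using walsh_expansion_ex1[OF assms(1)] assms(2) by blast
  then show ?thesis
    unfolding D_op_def Let_def using sum_support[OF assms(3,4)] by simp
qed

lemma local_fun_walsh: "finite A \<Longrightarrow> local_fun (walsh A)"
  unfolding local_fun_def walsh_def by (intro exI[of _ A]) (auto intro: prod.cong)

lemma D_op_walsh:
  assumes "finite A"
  shows "D_op (walsh A) \<sigma> = (\<Sum>r\<in>uminus ` A. (-2) * walsh ((\<lambda>j. j + r) ` A) \<sigma>)"
proof -
  let ?a = "\<lambda>B. if B = A then 1 else 0 :: real"
  have "walsh_expansion (walsh A) ?a"
    using assms by (auto simp: walsh_expansion_def)
  from D_op_eq[OF local_fun_walsh[OF assms] this assms]
  have "D_op (walsh A) \<sigma> = (\<Sum>B\<in>Pow A. ?a B * (\<Sum>r\<in>uminus ` B. (-2) * walsh ((\<lambda>j. j + r) ` B) \<sigma>))"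
    by auto
  also have "\<dots> = (\<Sum>B\<in>Pow A. if B = A then \<Sum>r\<in>uminus ` B. (-2) * walsh ((\<lambda>j. j + r) ` B) \<sigma> else 0)"
    by (intro sum.cong) auto
  finally show ?thesis using assms by simp
qed

lemma D_op_one: "D_op (\<lambda>_. 1) \<sigma> = 0"
  using D_op_walsh[of "{}" \<sigma>] by (simp add: walsh_def[abs_def])

lemma local_fun_lincomb:
  assumes "local_fun f" "local_fun g"
  shows "local_fun (\<lambda>\<sigma>. x * f \<sigma> + y * g \<sigma>)"
proof -
  obtain S T where "finite S" "finite T"
    and S: "\<forall>\<sigma>\<in>Omega. \<forall>\<eta>\<in>Omega. (\<forall>j\<in>S. \<sigma> j = \<eta> j) \<longrightarrow> f \<sigma> = f \<eta>"
    and T: "\<forall>\<sigma>\<in>Omega. \<forall>\<eta>\<in>Omega. (\<forall>j\<in>T. \<sigma> j = \<eta> j) \<longrightarrow> g \<sigma> = g \<eta>"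
    using assms unfolding local_fun_def by blast
  show ?thesis
    unfolding local_fun_def
  proof (intro exI[of _ "S \<union> T"] conjI ballI impI)
    fix \<sigma> \<eta> :: "'a config"
    assume *: "\<sigma> \<in> Omega" "\<eta> \<in> Omega" "\<forall>j\<in>S \<union> T. \<sigma> j = \<eta> j"
    then have "f \<sigma> = f \<eta>" "g \<sigma> = g \<eta>" using S T by blast+
    then show "x * f \<sigma> + y * g \<sigma> = x * f \<eta> + y * g \<eta>" by simp
  qed (use \<open>finite S\<close> \<open>finite T\<close> in simp)
qed

lemma D_op_linear:
  assumes "local_fun f" "local_fun g"
  shows "D_op (\<lambda>\<sigma>. x * f \<sigma> + y * g \<sigma>) \<sigma> = x * D_op f \<sigma> + y * D_op g \<sigma>"
proof -
  obtain a b where a: "walsh_expansion f a" and b: "walsh_expansion g b"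
    using walsh_expansion_ex1 assms by metis
  let ?c = "\<lambda>A. x * a A + y * b A"
  define U where "U = \<Union>({A. a A \<noteq> 0} \<union> {A. b A \<noteq> 0})"
  have U: "finite U" "{A. a A \<noteq> 0} \<subseteq> Pow U" "{A. b A \<noteq> 0} \<subseteq> Pow U"
    using a b by (auto simp: U_def walsh_expansion_def)
  have Uc: "{A. ?c A \<noteq> 0} \<subseteq> Pow U"
  proof
    fix A assume "A \<in> {A. ?c A \<noteq> 0}"
    then have "a A \<noteq> 0 \<or> b A \<noteq> 0" by auto
    then show "A \<in> Pow U" using U by blast
  qed
  have c: "walsh_expansion (\<lambda>\<sigma>. x * f \<sigma> + y * g \<sigma>) ?c"
    unfolding walsh_expansion_def
  proof (intro conjI ballI allI impI)
    show "finite {A. ?c A \<noteq> 0}" using Uc U(1) finite_subset by blast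
    show "finite A" if "?c A \<noteq> 0" for A using Uc U(1) that finite_subset by blast
    show "x * f \<sigma> + y * g \<sigma> = (\<Sum>A | ?c A \<noteq> 0. ?c A * walsh A \<sigma>)" if "\<sigma> \<in> Omega" for \<sigma>
      unfolding sum_support[OF U(1) Uc] using a b that
      by (simp add: walsh_expansion_def sum_support[OF U(1,2)] sum_support[OF U(1,3)]
          distrib_right sum.distrib sum_distrib_left mult.assoc)
  qed
  show ?thesis
    unfolding D_op_eq[OF local_fun_lincomb[OF assms] c U(1) Uc] D_op_eq[OF assms(1) a U(1,2)]
      D_op_eq[OF assms(2) b U(1,3)]
    unfolding sum_distrib_left[of _ _ "Pow U"] sum.distrib[symmetric]
    by (intro sum.cong refl) (simp only: distrib_right mult.assoc)
qed

end

theory Submission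
  imports Defs
begin

text \<open>
  Write \<open>T\<close> for the number of sites, \<open>m(\<sigma>)\<close> for the vector of the averages
  \<open>\<langle>f\<^sub>k, \<L>\<^sub>N(\<sigma>)\<rangle>\<close>, and \<open>z\<close> for its limit, the vector of the \<open>\<langle>f\<^sub>k, \<mu>\<rangle>\<close>. The prefactor of the
  non-linear generator can be absorbed into the exponentials, which turns \<open>(H\<^sub>N F)(\<L>\<^sub>N(\<sigma>))\<close> into the
  spatial average over \<open>i\<close> of
  \<open>c(\<tau>\<^sub>i \<sigma>) (exp (T (\<Psi> (m(\<sigma>\<^sup>i)) - \<Psi> (m(\<sigma>)))) - 1)\<close> (\<open>nonlin_gen_eq_average\<close>).

  A single flip changes a spatial sum of local functions only by an amount of order one, and \<open>\<D>\<close>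
  computes this amount without error: as soon as the box contains the dependence set of \<open>f\<^sub>k\<close>,
  \<open>T (m\<^sub>k(\<sigma>\<^sup>i) - m\<^sub>k(\<sigma>)) = (\<D> f\<^sub>k)(\<tau>\<^sub>i \<sigma>)\<close> (\<open>eventually_sum_flip_difference_eq_D_op\<close>). Indeed, flipping
  the spin at \<open>i\<close> reverses the sign of the translate \<open>A + j\<close> of a Walsh function exactly when
  \<open>j = i - a\<close> for some \<open>a \<in> A\<close>, and the translates of this form, seen from \<open>i\<close>, are the sets
  \<open>A + r\<close> with \<open>r \<in> -A\<close>.

  Hence both \<open>m(\<sigma>)\<close> and \<open>m(\<sigma>\<^sup>i)\<close> lie close to \<open>z\<close>, at distance \<open>O(1/T)\<close> of each other. Continuity of the
  partial derivatives of \<open>\<Psi>\<close> at \<open>z\<close> makes \<open>\<Psi>\<close> strictly differentiable there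
  (\<open>smooth_strictly_differentiable\<close>), so \<open>T (\<Psi> (m(\<sigma>\<^sup>i)) - \<Psi> (m(\<sigma>)))\<close> differs from
  \<open>V(\<tau>\<^sub>i \<sigma>)\<close>, where \<open>V = \<Sum>\<^sub>k \<partial>\<^sub>k\<Psi>(z) \<D> f\<^sub>k\<close>, by an error that tends to \<open>0\<close> uniformly in \<open>i\<close>. The
  exponentials may then be exchanged inside the average, because \<open>c\<close> and \<open>V\<close>, being local, are bounded.
  What remains is the average of the local function \<open>c (exp V - 1)\<close> over the translates of \<open>\<sigma>\<close>, and
  its convergence is what weak convergence of the empirical measures asserts.
\<close>

section \<open>Local functions\<close>

lemma local_fun_const: "local_fun (\<lambda>_. x)"
  unfolding local_fun_def by (intro exI[of _ "{}"]) simp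

lemma local_fun_compose2:
  assumes "local_fun f" "local_fun g"
  shows "local_fun (\<lambda>\<sigma>. h (f \<sigma>) (g \<sigma>))"
proof -
  obtain S T where S: "finite S" "\<forall>\<sigma>\<in>Omega. \<forall>\<eta>\<in>Omega. (\<forall>j\<in>S. \<sigma> j = \<eta> j) \<longrightarrow> f \<sigma> = f \<eta>"
    and T: "finite T" "\<forall>\<sigma>\<in>Omega. \<forall>\<eta>\<in>Omega. (\<forall>j\<in>T. \<sigma> j = \<eta> j) \<longrightarrow> g \<sigma> = g \<eta>"
    using assms unfolding local_fun_def by blast
  show ?thesis
    unfolding local_fun_def
  proof (intro exI[of _ "S \<union> T"] conjI ballI impI)
    fix \<sigma> \<eta> :: "'a config"
    assume *: "\<sigma> \<in> Omega" "\<eta> \<in> Omega" "\<forall>j\<in>S \<union> T. \<sigma> j = \<eta> j"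
    then have "f \<sigma> = f \<eta>" "g \<sigma> = g \<eta>" using S T by blast+
    then show "h (f \<sigma>) (g \<sigma>) = h (f \<eta>) (g \<eta>)" by simp
  qed (use S T in simp)
qed

lemma local_fun_scale: "local_fun f \<Longrightarrow> local_fun (\<lambda>\<sigma>. x * f \<sigma>)"
  using local_fun_compose2[of f f "\<lambda>y _. x * y"] by simp

lemma local_fun_sum:
  assumes "finite I" "\<And>i. i \<in> I \<Longrightarrow> local_fun (f i)"
  shows "local_fun (\<lambda>\<sigma>. \<Sum>i\<in>I. f i \<sigma>)"
  using assms
proof (induction I rule: finite_induct)
  case empty
  then show ?case by (simp add: local_fun_const)
next
  case (insert i I)
  then show ?case
    using local_fun_compose2[of "f i" "\<lambda>\<sigma>. \<Sum>i\<in>I. f i \<sigma>" "(+)"] by simp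
qed

lemma abs_walsh: "\<sigma> \<in> Omega \<Longrightarrow> \<bar>walsh A \<sigma>\<bar> = 1"
proof -
  assume "\<sigma> \<in> Omega"
  then have "\<sigma> j = -1 \<or> \<sigma> j = 1" for j
    by (auto simp: Omega_def)
  then have "\<bar>\<sigma> j\<bar> = 1" for j
    by (metis abs_1 abs_minus_cancel)
  then show ?thesis by (simp add: walsh_def abs_prod)
qed

lemma local_fun_bounded:
  assumes "local_fun f"
  obtains B where "0 \<le> B" "\<And>\<sigma>. \<sigma> \<in> Omega \<Longrightarrow> \<bar>f \<sigma>\<bar> \<le> B"
proof -
  obtain a where a: "walsh_expansion f a"
    using walsh_expansion_ex1[OF assms] by blast
  let ?B = "\<Sum>A | a A \<noteq> 0. \<bar>a A\<bar>"
  have "\<bar>f \<sigma>\<bar> \<le> ?B" if \<sigma>: "\<sigma> \<in> Omega" for \<sigma>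
  proof -
    have "\<bar>f \<sigma>\<bar> \<le> (\<Sum>A | a A \<noteq> 0. \<bar>a A * walsh A \<sigma>\<bar>)"
      using a \<sigma> by (simp add: walsh_expansion_def)
    then show ?thesis using \<sigma> by (simp add: abs_mult abs_walsh)
  qed
  then show ?thesis using that[of ?B] by (simp add: sum_nonneg)
qed

text \<open>
  The formula \<open>D_op_eq\<close> for \<open>\<D>\<close> sums over the subsets of one finite set; this lemma provides the set.
\<close>

lemma local_fun_finite_expansion:
  assumes "local_fun f"
  obtains S a where "finite S" "walsh_expansion f a" "{A. a A \<noteq> 0} \<subseteq> Pow S"
proof -
  obtain a where a: "walsh_expansion f a"
    using walsh_expansion_ex1[OF assms] by blast
  then have "finite (\<Union>{A. a A \<noteq> 0})" by (auto simp: walsh_expansion_def)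
  then show ?thesis by (rule that[OF _ a]) blast
qed

lemma local_fun_D_op:
  assumes "local_fun f"
  shows "local_fun (D_op f)"
proof -
  obtain S a where S: "finite S" and a: "walsh_expansion f a" "{A. a A \<noteq> 0} \<subseteq> Pow S"
    by (rule local_fun_finite_expansion[OF assms])
  have "D_op f = (\<lambda>\<sigma>. \<Sum>A\<in>Pow S. a A * (\<Sum>r\<in>uminus ` A. (-2) * walsh ((\<lambda>j. j + r) ` A) \<sigma>))"
    by (rule ext, rule D_op_eq[OF assms a(1) S a(2)])
  moreover have "local_fun (\<lambda>\<sigma>. \<Sum>A\<in>Pow S. a A * (\<Sum>r\<in>uminus ` A. (-2) * walsh ((\<lambda>j. j + r) ` A) \<sigma>))"
    using S by (intro local_fun_sum local_fun_scale local_fun_walsh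
        finite_Pow_iff[THEN iffD2] finite_imageI) (auto intro: finite_subset)
  ultimately show ?thesis by (simp only:)
qed


section \<open>Averages over the torus\<close>

text \<open>
  The shifted configuration \<open>\<tau>\<^sub>i \<sigma>\<close>, extended periodically to all of \<open>\<int>\<^sup>d\<close>. Unlike
  \<open>torus_shift N i \<sigma>\<close>, which is only meaningful on the box, it lies in \<open>Omega\<close>, so that local
  functions and their Walsh expansions can be evaluated at it directly.
\<close>

definition unroll :: "nat \<Rightarrow> (int, 'd::finite) vec \<Rightarrow> 'd config \<Rightarrow> 'd config" where
  "unroll N i \<sigma> = (\<lambda>j. \<sigma> (wrap N (i + j)))"

lemma wrap_add_wrap: "wrap N (i + wrap N j) = wrap N (i + j)"
  by (simp add: wrap_def vec_eq_iff mod_simps add.assoc)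

lemma on_torus_shift: "on_torus N f (torus_shift N i \<sigma>) = f (unroll N i \<sigma>)"
  by (simp add: on_torus_def torus_shift_def unroll_def wrap_in_torus wrap_add_wrap)

lemma unroll_in_Omega: "\<sigma> \<in> Omega_N N \<Longrightarrow> unroll N i \<sigma> \<in> Omega"
  using wrap_in_torus by (auto simp: Omega_def Omega_N_def PiE_def Pi_def unroll_def)

lemma eventually_subset_torus:
  fixes S :: "(int, 'd::finite) vec set"
  assumes "finite S"
  shows "\<forall>\<^sub>F N in sequentially. S \<subseteq> torus N"
proof -
  have "\<forall>\<^sub>F N in sequentially. j \<in> torus N" for j :: "(int, 'd) vec"
  proof (rule eventually_sequentiallyI[of "nat (\<Sum>k\<in>UNIV. \<bar>j $ k\<bar>)"])
    fix N assume N: "nat (\<Sum>k\<in>UNIV. \<bar>j $ k\<bar>) \<le> N"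
    have "\<bar>j $ k\<bar> \<le> int N" for k
    proof -
      have "\<bar>j $ k\<bar> \<le> (\<Sum>k\<in>UNIV. \<bar>j $ k\<bar>)" by (intro member_le_sum) auto
      then show ?thesis using N by linarith
    qed
    then show "j \<in> torus N" by (simp add: torus_def abs_le_iff minus_le_iff)
  qed
  then have "\<forall>\<^sub>F N in sequentially. \<forall>j\<in>S. j \<in> torus N"
    using assms by (intro eventually_ball_finite) auto
  then show ?thesis by (simp add: subset_eq)
qed

lemma integral_empirical:
  fixes \<sigma> :: "'d::finite config"
  assumes "\<sigma> \<in> Omega_N N"
  shows "(\<integral>\<eta>. on_torus N f \<eta> \<partial>empirical N \<sigma>) =
    (\<Sum>i\<in>torus N. f (unroll N i \<sigma>)) / real (card (torus N :: (int, 'd) vec set))"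
proof -
  have "(\<lambda>i. torus_shift N i \<sigma>) \<in>
      measurable (uniform_count_measure (torus N)) (count_space (Omega_N N))"
    using assms by (auto simp: measurable_def space_uniform_count_measure
        sets_uniform_count_measure torus_shift_in_Omega_N)
  then have "(\<integral>\<eta>. on_torus N f \<eta> \<partial>empirical N \<sigma>) =
      (\<integral>i. f (unroll N i \<sigma>) \<partial>uniform_count_measure (torus N))"
    unfolding empirical_def by (subst integral_distr) (auto simp: on_torus_shift)
  then show ?thesis by (simp add: integral_uniform_count_measure finite_torus)
qed

text \<open>
  The set \<open>A\<close> injects into the torus, so at most one factor of the translated Walsh function is the spin
  at \<open>i\<close>. If there is one, the flip reverses the sign; otherwise nothing changes. The right-hand
  side, a sum with at most one nonzero term, allows the sum over the translates to be
  exchanged with the one over \<open>A\<close>.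
\<close>

lemma walsh_flip_difference:
  assumes \<sigma>: "\<sigma> \<in> Omega_N N" and i: "i \<in> torus N" and A: "finite A" "A \<subseteq> torus N"
  shows "walsh A (unroll N j (flip_at i \<sigma>)) - walsh A (unroll N j \<sigma>) =
    (\<Sum>a\<in>A. if wrap N (j + a) = i then -2 * walsh A (unroll N j \<sigma>) else 0)"
proof (cases "\<exists>a\<in>A. wrap N (j + a) = i")
  case True
  then obtain a where a: "a \<in> A" "wrap N (j + a) = i" by blast
  have unique: "wrap N (j + b) = i \<longleftrightarrow> b = a" if "b \<in> A" for b
  proof
    assume "wrap N (j + b) = i"
    then have "wrap N (- j + wrap N (j + b)) = wrap N (- j + wrap N (j + a))" using a by simp
    then have "wrap N b = wrap N a" by (simp only: wrap_add_wrap minus_add_cancel)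
    then show "b = a" using that a A by (metis subsetD wrap_torus)
  qed (use a in simp)
  have "walsh A (unroll N j (flip_at i \<sigma>)) = - \<sigma> i * (\<Prod>b\<in>A - {a}. \<sigma> (wrap N (j + b)))"
    unfolding walsh_def prod.remove[OF A(1) a(1)]
    using a unique by (intro arg_cong2[of _ _ _ _ "(*)"] prod.cong) (auto simp: unroll_def flip_at_def)
  moreover have "walsh A (unroll N j \<sigma>) = \<sigma> i * (\<Prod>b\<in>A - {a}. \<sigma> (wrap N (j + b)))"
    unfolding walsh_def prod.remove[OF A(1) a(1)] using a by (simp add: unroll_def)
  moreover have "(\<Sum>b\<in>A. if wrap N (j + b) = i then -2 * walsh A (unroll N j \<sigma>) else 0) =
      (\<Sum>b\<in>A. if b = a then -2 * walsh A (unroll N j \<sigma>) else 0)"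
    using unique by (intro sum.cong) auto
  ultimately show ?thesis using A(1) a(1) by simp
next
  case False
  then have "walsh A (unroll N j (flip_at i \<sigma>)) = walsh A (unroll N j \<sigma>)"
    unfolding walsh_def by (intro prod.cong) (auto simp: unroll_def flip_at_def)
  then show ?thesis using False by (auto intro!: sum.neutral[symmetric])
qed

text \<open>
  For each \<open>a \<in> A\<close> exactly one translate of the Walsh function of \<open>A\<close> puts \<open>a\<close> on the flipped site \<open>i\<close>,
  namely the one by \<open>i - a\<close>. Relative to \<open>i\<close> its support is \<open>A - a\<close>, which explains both the shifts by
  \<open>r \<in> -A\<close> and the factor \<open>-2\<close> in the definition of \<open>\<D>\<close>.
\<close>

lemma sum_walsh_flip_difference:
  assumes \<sigma>: "\<sigma> \<in> Omega_N N" and i: "i \<in> torus N" and A: "finite A" "A \<subseteq> torus N"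
  shows "(\<Sum>j\<in>torus N. walsh A (unroll N j (flip_at i \<sigma>)) - walsh A (unroll N j \<sigma>)) =
    (\<Sum>r\<in>uminus ` A. (-2) * walsh ((\<lambda>j. j + r) ` A) (unroll N i \<sigma>))"
proof -
  have "wrap N (j + a) = i \<longleftrightarrow> j = wrap N (i - a)" if "j \<in> torus N" for j a
  proof
    assume "wrap N (j + a) = i"
    then have "wrap N (i - a) = wrap N (- a + wrap N (a + j))" by (simp add: add.commute)
    then have "wrap N (i - a) = wrap N j" by (simp only: wrap_add_wrap minus_add_cancel)
    then show "j = wrap N (i - a)" using that by (simp add: wrap_torus)
  next
    assume "j = wrap N (i - a)"
    then have "wrap N (j + a) = wrap N (a + wrap N (i - a))" by (simp add: add.commute)
    then show "wrap N (j + a) = i" using i by (simp add: wrap_add_wrap wrap_torus)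
  qed
  then have "(\<Sum>j\<in>torus N. walsh A (unroll N j (flip_at i \<sigma>)) - walsh A (unroll N j \<sigma>)) =
      (\<Sum>j\<in>torus N. \<Sum>a\<in>A. if j = wrap N (i - a) then -2 * walsh A (unroll N j \<sigma>) else 0)"
    unfolding walsh_flip_difference[OF assms] by (intro sum.cong) auto
  also have "\<dots> = (\<Sum>a\<in>A. -2 * walsh A (unroll N (wrap N (i - a)) \<sigma>))"
    by (subst sum.swap) (simp add: finite_torus wrap_in_torus)
  also have "\<dots> = (\<Sum>a\<in>A. -2 * walsh ((\<lambda>j. j + - a) ` A) (unroll N i \<sigma>))"
  proof (intro sum.cong refl arg_cong2[of _ _ _ _ "(*)"])
    fix a
    have "wrap N (wrap N (i - a) + b) = wrap N (i + (b + - a))" for b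
      using wrap_add_wrap[of N b "i - a"] by (simp add: algebra_simps)
    then show "walsh A (unroll N (wrap N (i - a)) \<sigma>) = walsh ((\<lambda>j. j + - a) ` A) (unroll N i \<sigma>)"
      unfolding walsh_def by (subst prod.reindex) (auto simp: inj_on_def unroll_def)
  qed
  also have "\<dots> = (\<Sum>r\<in>uminus ` A. -2 * walsh ((\<lambda>j. j + r) ` A) (unroll N i \<sigma>))"
    by (subst sum.reindex) (auto simp: inj_on_def)
  finally show ?thesis .
qed

text \<open>
  By linearity the identity passes to local functions. It is exact once the box contains the sites of
  the Walsh expansion, and the threshold for \<open>N\<close> depends neither on the configuration nor on the
  flipped site; this is the uniformity on which the limit rests.
\<close>

lemma eventually_sum_flip_difference_eq_D_op:
  fixes f :: "'d::finite config \<Rightarrow> real"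
  assumes "local_fun f"
  shows "\<forall>\<^sub>F N in sequentially. \<forall>\<sigma>\<in>Omega_N N. \<forall>i\<in>torus N.
    (\<Sum>j\<in>torus N. f (unroll N j (flip_at i \<sigma>)) - f (unroll N j \<sigma>)) = D_op f (unroll N i \<sigma>)"
proof -
  obtain S a where S: "finite S" and a: "walsh_expansion f a" "{A. a A \<noteq> 0} \<subseteq> Pow S"
    by (rule local_fun_finite_expansion[OF assms])
  have f: "f \<eta> = (\<Sum>A\<in>Pow S. a A * walsh A \<eta>)" if "\<eta> \<in> Omega" for \<eta>
    using a(1) that by (simp add: walsh_expansion_def sum_support[OF S a(2)])
  show ?thesis
    using eventually_subset_torus[OF S]
  proof (eventually_elim, intro ballI)
    fix N and \<sigma> :: "'d config" and i :: "(int, 'd) vec"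
    assume N: "S \<subseteq> torus N" and \<sigma>: "\<sigma> \<in> Omega_N N" and i: "i \<in> torus N"
    have "(\<Sum>j\<in>torus N. f (unroll N j (flip_at i \<sigma>)) - f (unroll N j \<sigma>)) =
        (\<Sum>j\<in>torus N. \<Sum>A\<in>Pow S.
          a A * (walsh A (unroll N j (flip_at i \<sigma>)) - walsh A (unroll N j \<sigma>)))"
      using \<sigma> i by (simp add: f unroll_in_Omega flip_at_in_Omega_N right_diff_distrib sum_subtractf)
    also have "\<dots> = (\<Sum>A\<in>Pow S. a A *
        (\<Sum>j\<in>torus N. walsh A (unroll N j (flip_at i \<sigma>)) - walsh A (unroll N j \<sigma>)))"
      by (subst sum.swap) (simp add: sum_distrib_left)
    also have "\<dots> = D_op f (unroll N i \<sigma>)"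
      unfolding D_op_eq[OF assms a(1) S a(2)]
      using S N by (intro sum.cong refl arg_cong2[of _ _ _ _ "(*)"]
          sum_walsh_flip_difference[OF \<sigma> i]) (auto intro: finite_subset)
    finally show "(\<Sum>j\<in>torus N. f (unroll N j (flip_at i \<sigma>)) - f (unroll N j \<sigma>)) =
        D_op f (unroll N i \<sigma>)" .
  qed
qed


section \<open>Increments of smooth functions\<close>

lemma frechet_derivative_eq_sum_partial:
  fixes g :: "(real, 'n::finite) vec \<Rightarrow> real"
  assumes "g differentiable (at x)"
  shows "frechet_derivative g (at x) v = (\<Sum>i\<in>UNIV. partial i g x * v $ i)"
proof -
  have lin: "linear (frechet_derivative g (at x))"
    using assms by (rule linear_frechet_derivative)
  have "frechet_derivative g (at x) v =
      frechet_derivative g (at x) (\<Sum>i\<in>UNIV. v $ i *\<^sub>R axis i 1)"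
    using basis_expansion[of v] by (simp add: scalar_mult_eq_scaleR)
  also have "\<dots> = (\<Sum>i\<in>UNIV. partial i g x * v $ i)"
    by (simp add: linear_sum[OF lin] linear_scale[OF lin] partial_def mult.commute)
  finally show ?thesis .
qed

text \<open>
  Differentiability at \<open>z\<close> compares values near \<open>z\<close> with the value at \<open>z\<close> only. Here both points move, and
  the error has to be small relative to their mutual distance, which is much smaller than their
  distance to \<open>z\<close>. This follows from the mean value inequality for \<open>g\<close> minus its linear part at
  \<open>z\<close>, whose derivative is small near \<open>z\<close> by continuity of the partial derivatives.
\<close>

lemma smooth_strictly_differentiable:
  fixes g :: "(real, 'n::finite) vec \<Rightarrow> real"
  assumes "smooth g" "0 < e"
  obtains d where "0 < d" "\<And>x y. x \<in> ball z d \<Longrightarrow> y \<in> ball z d \<Longrightarrow>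
    \<bar>g y - g x - (\<Sum>i\<in>UNIV. partial i g z * (y - x) $ i)\<bar> \<le> e * norm (y - x)"
proof -
  define n where "n = real CARD('n)"
  have n: "0 < n" by (simp add: n_def)
  have diff: "g differentiable (at x)" for x
    using assms(1)[unfolded smooth_def, rule_format, of "[]"] by simp
  have "isCont (partial i g) z" for i
    using assms(1)[unfolded smooth_def, rule_format, of "[i]"]
    by (simp add: differentiable_imp_continuous_within)
  then have "\<forall>\<^sub>F x in nhds z. dist (partial i g x) (partial i g z) < e / n" for i
    using assms(2) n
    by (intro tendstoD) (auto simp: isCont_def tendsto_at_iff_tendsto_nhds)
  then have "\<forall>\<^sub>F x in nhds z. \<forall>i. dist (partial i g x) (partial i g z) < e / n"
    by (intro eventually_all_finite) auto
  then obtain d where d: "0 < d"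
    "\<And>x i. x \<in> ball z d \<Longrightarrow> \<bar>partial i g x - partial i g z\<bar> < e / n"
    unfolding eventually_nhds_metric by (auto simp: dist_real_def dist_commute)
  define h where "h x = g x - (\<Sum>i\<in>UNIV. partial i g z * x $ i)" for x
  define h' where "h' x v = (\<Sum>i\<in>UNIV. (partial i g x - partial i g z) * v $ i)" for x v
  have deriv: "(h has_derivative h' x) (at x within ball z d)" for x
  proof -
    have "(g has_derivative (\<lambda>v. \<Sum>i\<in>UNIV. partial i g x * v $ i)) (at x)"
      using diff[of x, THEN frechet_derivative_works[THEN iffD1]]
      by (simp add: frechet_derivative_eq_sum_partial[OF diff, abs_def])
    then have "(h has_derivative
        (\<lambda>v. (\<Sum>i\<in>UNIV. partial i g x * v $ i) - (\<Sum>i\<in>UNIV. partial i g z * v $ i))) (at x)"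
      unfolding h_def by (intro has_derivative_diff has_derivative_sum has_derivative_mult_right
          bounded_linear.has_derivative[OF bounded_linear_vec_nth] has_derivative_ident)
    then have "(h has_derivative h' x) (at x)"
      by (simp add: h'_def[abs_def] left_diff_distrib sum_subtractf)
    then show ?thesis by (rule has_derivative_at_withinI)
  qed
  have bound: "onorm (h' x) \<le> e" if x: "x \<in> ball z d" for x
  proof (rule onorm_le)
    fix v :: "(real, 'n) vec"
    have "norm (h' x v) \<le> (\<Sum>i\<in>UNIV. \<bar>(partial i g x - partial i g z) * v $ i\<bar>)"
      unfolding h'_def real_norm_def by (rule sum_abs)
    also have "\<dots> \<le> (\<Sum>i\<in>(UNIV::'n set). e / n * norm v)"
      unfolding abs_mult using d(2)[OF x] assms(2) n
      by (intro sum_mono mult_mono) (auto simp: component_le_norm_cart less_imp_le)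
    also have "\<dots> = e * norm v" using n by (simp add: n_def)
    finally show "norm (h' x v) \<le> e * norm v" .
  qed
  have "\<bar>g y - g x - (\<Sum>i\<in>UNIV. partial i g z * (y - x) $ i)\<bar> \<le> e * norm (y - x)"
    if "x \<in> ball z d" "y \<in> ball z d" for x y
  proof -
    have "g y - g x - (\<Sum>i\<in>UNIV. partial i g z * (y - x) $ i) = h y - h x"
      by (simp add: h_def right_diff_distrib sum_subtractf)
    then show ?thesis
      using differentiable_bound[OF convex_ball deriv bound that(2,1)] by simp
  qed
  with d(1) show ?thesis using that by blast
qed

lemma abs_exp_diff_le:
  fixes a b :: real
  assumes "\<bar>a - b\<bar> \<le> e" "\<bar>b\<bar> \<le> M"
  shows "\<bar>exp a - exp b\<bar> \<le> exp M * (exp e - 1)"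
proof -
  have "\<bar>exp (a - b) - 1\<bar> \<le> exp \<bar>a - b\<bar> - 1"
  proof (cases "b \<le> a")
    case False
    have "2 - exp (a - b) \<le> exp (b - a)"
      using exp_ge_add_one_self[of "a - b"] exp_ge_add_one_self[of "b - a"] by linarith
    then show ?thesis using False by simp
  qed simp
  also have "\<dots> \<le> exp e - 1" using assms(1) by simp
  finally have *: "\<bar>exp (a - b) - 1\<bar> \<le> exp e - 1" .
  have "\<bar>exp a - exp b\<bar> = exp b * \<bar>exp (a - b) - 1\<bar>"
    by (simp add: exp_diff field_simps flip: abs_mult_pos)
  also have "\<dots> \<le> exp M * (exp e - 1)"
    using * assms(2) by (intro mult_mono) auto
  finally show ?thesis .
qed


section \<open>The limit of the non-linear generators\<close>

text \<open>
  Multiplying the generator by \<open>exp (- T F)\<close> leaves the exponential of the increment of \<open>T F\<close>, which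
  stays bounded although \<open>T F\<close> itself is of order \<open>T\<close>.
\<close>

lemma nonlin_gen_eq_average:
  fixes \<sigma> :: "'d::finite config"
  defines "T N \<equiv> real (card (torus N :: (int, 'd) vec set))"
  shows "nonlin_gen N c F \<sigma> = (\<Sum>i\<in>torus N. c (unroll N i \<sigma>) *
    (exp (T N * (F (empirical N (flip_at i \<sigma>)) - F (empirical N \<sigma>))) - 1)) / T N"
proof -
  have "exp (- T N * F (empirical N \<sigma>)) *
      (exp (T N * F (empirical N \<eta>)) - exp (T N * F (empirical N \<sigma>))) =
      exp (T N * (F (empirical N \<eta>) - F (empirical N \<sigma>))) - 1" for \<eta>
    by (simp add: right_diff_distrib exp_diff exp_minus field_simps)
  then have *: "exp (- T N * F (empirical N \<sigma>)) * (x *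
      (exp (T N * F (empirical N \<eta>)) - exp (T N * F (empirical N \<sigma>)))) =
      x * (exp (T N * (F (empirical N \<eta>) - F (empirical N \<sigma>))) - 1)" for \<eta> x
    by (metis mult.left_commute)
  have "nonlin_gen N c F \<sigma> = (\<Sum>i\<in>torus N. exp (- T N * F (empirical N \<sigma>)) *
      (c (unroll N i \<sigma>) * (exp (T N * F (empirical N (flip_at i \<sigma>))) -
        exp (T N * F (empirical N \<sigma>))))) / T N"
    by (simp add: nonlin_gen_def gen_def on_torus_shift T_def Let_def sum_distrib_left
        sum_divide_distrib)
  then show ?thesis by (simp only: *)
qed

theorem theorem2:
  fixes c :: "'d::finite config \<Rightarrow> real"
    and f :: "'n::finite \<Rightarrow> 'd config \<Rightarrow> real"
    and \<Psi> :: "(real, 'n) vec \<Rightarrow> real"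
    and \<mu> :: "'d config measure"
    and \<sigma> :: "nat \<Rightarrow> 'd config"
  assumes "local_fun c" and "\<forall>\<eta>\<in>Omega. 0 < c \<eta>"
    and "\<forall>i. local_fun (f i)"
    and "smooth \<Psi>" and "bounded_derivs \<Psi>"
    and "prob_space \<mu>" and "sets \<mu> = sets spin_space"
    and "\<forall>N. \<sigma> N \<in> Omega_N N"
    and "weakly_converges (\<lambda>N. empirical N (\<sigma> N)) \<mu>"
  shows "(\<lambda>N. nonlin_gen N c (cylinder \<Psi> (\<lambda>i. on_torus N (f i))) (\<sigma> N))
    \<longlonglongrightarrow> (\<integral>\<eta>. c \<eta> *
          (exp (\<Sum>i\<in>UNIV. partial i \<Psi> (\<chi> j. \<integral>\<xi>. f j \<xi> \<partial>\<mu>) * D_op (f i) \<eta>) - 1) \<partial>\<mu>)"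
proof -
  define z where "z = (\<chi> j. \<integral>\<xi>. f j \<xi> \<partial>\<mu>)"
  define p where "p k = partial k \<Psi> z" for k
  define T where "T N = real (card (torus N :: (int, 'd) vec set))" for N
  define m where "m N \<eta> = (\<chi> k. \<integral>\<xi>. on_torus N (f k) \<xi> \<partial>empirical N \<eta>)" for N \<eta>
  define V where "V \<eta> = (\<Sum>k\<in>UNIV. p k * D_op (f k) \<eta>)" for \<eta>
  define g where "g \<eta> = c \<eta> * (exp (V \<eta>) - 1)" for \<eta>
  define u where "u N i = unroll N i (\<sigma> N)" for N i
  define U where "U N i = T N * (\<Psi> (m N (flip_at i (\<sigma> N))) - \<Psi> (m N (\<sigma> N)))" for N i
  note \<sigma> = assms(8)[rule_format]
  note f = assms(3)[rule_format]
  have u: "u N i \<in> Omega" for N i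
    unfolding u_def by (rule unroll_in_Omega[OF \<sigma>])
  have T_pos: "0 < T N" for N
    by (simp add: T_def card_gt_0_iff finite_torus torus_nonempty)
  have T_ge: "real N \<le> T N" for N
  proof -
    have "2 * N + 1 \<le> (2 * N + 1) ^ CARD('d)" by (rule self_le_power) auto
    then have "N \<le> (2 * N + 1) ^ CARD('d)" by linarith
    then show ?thesis unfolding T_def card_torus by (simp only: of_nat_le_iff)
  qed
  have T_lim: "filterlim T at_top sequentially"
    by (rule filterlim_at_top_mono[OF filterlim_real_sequentially]) (simp add: T_ge)

  have local_V: "local_fun V"
    unfolding V_def
    by (intro local_fun_sum local_fun_scale local_fun_D_op f) simp
  have local_g: "local_fun g"
    unfolding g_def by (rule local_fun_compose2[OF assms(1) local_V, of "\<lambda>x y. x * (exp y - 1)"])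
  obtain C where C: "0 \<le> C" "\<And>\<eta>. \<eta> \<in> Omega \<Longrightarrow> \<bar>c \<eta>\<bar> \<le> C"
    using local_fun_bounded[OF assms(1)] by blast
  obtain M where M: "\<And>\<eta>. \<eta> \<in> Omega \<Longrightarrow> \<bar>V \<eta>\<bar> \<le> M"
    using local_fun_bounded[OF local_V] by blast
  have "\<forall>k. \<exists>B. \<forall>\<eta>\<in>Omega. \<bar>D_op (f k) \<eta>\<bar> \<le> B"
    using local_fun_bounded[OF local_fun_D_op[OF f]] by metis
  then obtain B where B: "\<And>k \<eta>. \<eta> \<in> Omega \<Longrightarrow> \<bar>D_op (f k) \<eta>\<bar> \<le> B k" by metis
  define K where "K = (\<Sum>k\<in>UNIV. B k)"

  have m_lim: "(\<lambda>N. m N (\<sigma> N)) \<longlonglongrightarrow> z"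
    using assms(9) f unfolding m_def z_def weakly_converges_def
    by (intro vec_tendstoI) auto
  have avg_lim: "(\<lambda>N. (\<Sum>i\<in>torus N. g (u N i)) / T N) \<longlonglongrightarrow> (\<integral>\<eta>. g \<eta> \<partial>\<mu>)"
    using assms(9)[unfolded weakly_converges_def, rule_format, OF local_g]
    by (simp add: integral_empirical[OF \<sigma>] u_def T_def)
  have gen_eq: "nonlin_gen N c (cylinder \<Psi> (\<lambda>i. on_torus N (f i))) (\<sigma> N) =
      (\<Sum>i\<in>torus N. c (u N i) * (exp (U N i) - 1)) / T N" for N
    unfolding nonlin_gen_eq_average U_def cylinder_def m_def u_def T_def ..

  have increment: "\<forall>\<^sub>F N in sequentially. \<forall>i\<in>torus N. \<forall>k.
      T N * (m N (flip_at i (\<sigma> N)) - m N (\<sigma> N)) $ k = D_op (f k) (u N i)"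
  proof -
    have "\<forall>\<^sub>F N in sequentially. \<forall>k. \<forall>\<sigma>\<in>Omega_N N. \<forall>i\<in>torus N.
        (\<Sum>j\<in>torus N. f k (unroll N j (flip_at i \<sigma>)) - f k (unroll N j \<sigma>)) =
          D_op (f k) (unroll N i \<sigma>)"
      by (intro eventually_all_finite eventually_sum_flip_difference_eq_D_op f)
    then show ?thesis
    proof (eventually_elim, intro ballI allI)
      fix N k and i :: "(int, 'd) vec"
      assume *: "\<forall>k. \<forall>\<sigma>\<in>Omega_N N. \<forall>i\<in>torus N.
        (\<Sum>j\<in>torus N. f k (unroll N j (flip_at i \<sigma>)) - f k (unroll N j \<sigma>)) =
          D_op (f k) (unroll N i \<sigma>)" and i: "i \<in> torus N"
      have "T N * (m N (flip_at i (\<sigma> N)) - m N (\<sigma> N)) $ k =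
          (\<Sum>j\<in>torus N. f k (unroll N j (flip_at i (\<sigma> N))) - f k (unroll N j (\<sigma> N)))"
        using T_pos[of N]
        by (simp add: m_def integral_empirical \<sigma> flip_at_in_Omega_N i sum_subtractf field_simps
            flip: T_def)
      then show "T N * (m N (flip_at i (\<sigma> N)) - m N (\<sigma> N)) $ k = D_op (f k) (u N i)"
        using * \<sigma> i by (simp add: u_def)
    qed
  qed

  have "(\<lambda>N. (\<Sum>i\<in>torus N. c (u N i) * (exp (U N i) - 1)) / T N -
      (\<Sum>i\<in>torus N. g (u N i)) / T N) \<longlonglongrightarrow> 0"
  proof (rule tendstoI)
    fix \<epsilon> :: real assume \<epsilon>: "0 < \<epsilon>"
    (* The choice of e: an error e * K in the exponents costs at most this much in the average. *)
    have "((\<lambda>e. C * (exp M * (exp (e * K) - 1))) \<longlongrightarrow> C * (exp M * (exp (0 * K) - 1))) (at_right 0)"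
      by (intro tendsto_intros)
    then have "\<forall>\<^sub>F e in at_right 0. C * (exp M * (exp (e * K) - 1)) < \<epsilon>"
      using \<epsilon> by (intro order_tendstoD(2)) auto
    then have "\<forall>\<^sub>F e in at_right 0. 0 < e \<and> C * (exp M * (exp (e * K) - 1)) < \<epsilon>"
      using eventually_at_right_less[of "0::real"] by eventually_elim auto
    then obtain e where e: "0 < e" "C * (exp M * (exp (e * K) - 1)) < \<epsilon>"
      using eventually_happens'[OF trivial_limit_at_right_real] by blast
    obtain d where d: "0 < d" "\<And>x y. x \<in> ball z d \<Longrightarrow> y \<in> ball z d \<Longrightarrow>
        \<bar>\<Psi> y - \<Psi> x - (\<Sum>i\<in>UNIV. partial i \<Psi> z * (y - x) $ i)\<bar> \<le> e * norm (y - x)"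
      using smooth_strictly_differentiable[OF assms(4) e(1)] by blast
    have "\<forall>\<^sub>F N in sequentially. dist (m N (\<sigma> N)) z < d / 2"
      using tendstoD[OF m_lim, of "d / 2"] d(1) by simp
    (* A flip moves m by at most K / T, so this keeps the flipped averages in the ball as well. *)
    moreover have "\<forall>\<^sub>F N in sequentially. 2 * K / d < T N"
      using T_lim by (simp add: filterlim_at_top_dense)
    ultimately show "\<forall>\<^sub>F N in sequentially.
        dist ((\<Sum>i\<in>torus N. c (u N i) * (exp (U N i) - 1)) / T N - (\<Sum>i\<in>torus N. g (u N i)) / T N) 0 < \<epsilon>"
      using increment
    proof eventually_elim
      case (elim N)
      define x where "x = m N (\<sigma> N)"
      have close: "\<bar>U N i - V (u N i)\<bar> \<le> e * K" if i: "i \<in> torus N" for i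
      proof -
        define y where "y = m N (flip_at i (\<sigma> N))"
        have inc: "T N * (y - x) $ k = D_op (f k) (u N i)" for k
          using elim(3) i by (simp add: x_def y_def)
        have "T N * norm (y - x) \<le> (\<Sum>k\<in>UNIV. \<bar>T N * (y - x) $ k\<bar>)"
          using norm_le_l1_cart[of "y - x"] T_pos[of N]
          by (simp add: abs_mult flip: sum_distrib_left)
        also have "\<dots> \<le> K"
          unfolding K_def inc by (intro sum_mono B u)
        finally have norm: "T N * norm (y - x) \<le> K" .
        also have "K < T N * (d / 2)" using elim(2) d(1) by (simp add: field_simps)
        finally have "norm (y - x) < d / 2"
          using T_pos[of N] by (simp only: mult_less_cancel_left_pos)
        then have "x \<in> ball z d" "y \<in> ball z d"
          using elim(1) d(1) dist_triangle[of z y x]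
          by (auto simp: dist_commute[of _ z] dist_norm[of x y] norm_minus_commute[of x y] x_def[symmetric])
        from d(2)[OF this]
        have "T N * \<bar>\<Psi> y - \<Psi> x - (\<Sum>k\<in>UNIV. p k * (y - x) $ k)\<bar> \<le> T N * (e * norm (y - x))"
          using T_pos[of N] by (simp add: p_def)
        also have "\<dots> \<le> e * K" using norm e(1) by (simp add: mult.left_commute)
        also have "T N * \<bar>\<Psi> y - \<Psi> x - (\<Sum>k\<in>UNIV. p k * (y - x) $ k)\<bar> =
            \<bar>T N * (\<Psi> y - \<Psi> x - (\<Sum>k\<in>UNIV. p k * (y - x) $ k))\<bar>"
          using T_pos[of N] by (simp add: abs_mult)
        also have "T N * (\<Psi> y - \<Psi> x - (\<Sum>k\<in>UNIV. p k * (y - x) $ k)) =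
            U N i - (\<Sum>k\<in>UNIV. p k * (T N * (y - x) $ k))"
          by (simp add: U_def x_def y_def right_diff_distrib sum_distrib_left mult.left_commute)
        finally show ?thesis unfolding inc V_def .
      qed
      let ?E = "C * (exp M * (exp (e * K) - 1))"
      have "\<bar>\<Sum>i\<in>torus N. c (u N i) * (exp (U N i) - 1) - g (u N i)\<bar> \<le>
          (\<Sum>i\<in>torus N. \<bar>c (u N i)\<bar> * \<bar>exp (U N i) - exp (V (u N i))\<bar>)"
        by (rule order_trans[OF sum_abs]) (simp add: g_def algebra_simps flip: abs_mult)
      also have "\<dots> \<le> (\<Sum>i\<in>(torus N :: (int, 'd) vec set). ?E)"
        using C M u by (intro sum_mono mult_mono abs_exp_diff_le close) auto
      also have "\<dots> = T N * ?E" by (simp add: T_def)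
      finally have "\<bar>\<Sum>i\<in>torus N. c (u N i) * (exp (U N i) - 1) - g (u N i)\<bar> / T N \<le> ?E"
        using T_pos[of N] by (simp add: field_simps)
      then show ?case
        using e(2) T_pos[of N] by (simp add: sum_subtractf flip: diff_divide_distrib)
    qed
  qed
  from tendsto_add[OF this avg_lim] show ?thesis
    by (simp add: gen_eq g_def V_def p_def z_def)
qed

end
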